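(* Let $\mathbf y$ be a normally distributed real random variable with mean $\mathbb E[\mathbf y]$ and variance $V>0$. For $\alpha,\beta,\nu>0$, put $\sigma=\beta(\nu+1)/\nu$ and consider the equation $$\dot m=-\mathbb E\left[\frac{\partial K}{\partial m}\right],\qquad \mathbb E\left[\frac{\partial K}{\partial m}\right]=\frac{\alpha+1/2}{(2\pi V)^{1/2}}\int_{-\infty}^{\infty}\frac{m-y}{\sigma+\frac{(m-y)^2}{2}}\,e^{-\frac{(\mathbb E[\mathbf y]-y)^2}{2V}}\,dy .$$ This equation has a unique equilibrium $m=\mathbb E[\mathbf y]$. It is stable in the sense that, for any $\alpha,\beta,\nu>0$, $$\dot m<0\ \text{ if } m>\mathbb E[\mathbf y],\qquad \dot m>0\ \text{ if } m<\mathbb E[\mathbf y].$$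
   Context: The equation is the $m$-component of the dynamical system $\dot m=-\mathbb E[\partial K/\partial m]$, $\dot\alpha=-\mathbb E[\partial K/\partial\alpha]$, $\dot\beta=-\mathbb E[\partial K/\partial\beta]$, $\dot\nu=-\mathbb E[\partial K/\partial\nu]$ for the parameters $m\in\mathbb R$, $\alpha,\beta,\nu>0$ of a normal-gamma prior. Here $K$ is the Kullback--Leibler divergence from the normal-gamma posterior (given an observation $y$) to the prior, differentiated with the posterior parameters held fixed, and expectations are over $\mathbf y$. Equilibrium means: for any given $\alpha,\beta,\nu>0$, a value of $m$ at which the right-hand side vanishes. *)

theory Defs
  imports "HOL-Probability.Probability"
begin

text \<open>
  Normal-gamma distribution of a pair (mean \<open>x\<close>, precision \<open>\<tau>\<close>): \<open>\<tau>\<close> is gamma distributed with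
  shape \<open>\<alpha>\<close> and \<^emph>\<open>rate\<close> \<open>\<beta>\<close>, and \<open>x\<close> given \<open>\<tau>\<close> is normal with mean \<open>m\<close> and precision \<open>\<nu> * \<tau>\<close>.
  Note that \<^const>\<open>normal_density\<close> takes the standard deviation, not the variance.
\<close>

definition normal_gamma_density :: "real \<Rightarrow> real \<Rightarrow> real \<Rightarrow> real \<Rightarrow> real \<times> real \<Rightarrow> real" where
  "normal_gamma_density m \<alpha> \<beta> \<nu> = (\<lambda>(x, \<tau>).
     if \<tau> > 0
     then \<beta> powr \<alpha> / Gamma \<alpha> * \<tau> powr (\<alpha> - 1) * exp (- \<beta> * \<tau>)
            * normal_density m (1 / sqrt (\<nu> * \<tau>)) x
     else 0)"

definition normal_gamma :: "real \<Rightarrow> real \<Rightarrow> real \<Rightarrow> real \<Rightarrow> (real \<times> real) measure" where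
  "normal_gamma m \<alpha> \<beta> \<nu> = density lborel (\<lambda>p. ennreal (normal_gamma_density m \<alpha> \<beta> \<nu> p))"

definition likelihood :: "real \<Rightarrow> real \<times> real \<Rightarrow> real" where
  "likelihood y = (\<lambda>(x, \<tau>). normal_density x (1 / sqrt \<tau>) y)"

text \<open>
  Bayes' rule for one observation \<open>y\<close>. For \<open>\<alpha>, \<beta>, \<nu> > 0\<close> the result is again normal-gamma, with
  parameters \<open>(\<nu> * m + y) / (\<nu> + 1)\<close>, \<open>\<alpha> + 1 / 2\<close>, \<open>\<beta> + \<nu> * (y - m)\<^sup>2 / (2 * (\<nu> + 1))\<close>, \<open>\<nu> + 1\<close>.
\<close>

definition posterior :: "real \<Rightarrow> real \<Rightarrow> real \<Rightarrow> real \<Rightarrow> real \<Rightarrow> (real \<times> real) measure" where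
  "posterior y m \<alpha> \<beta> \<nu> = density (normal_gamma m \<alpha> \<beta> \<nu>)
     (\<lambda>p. ennreal (likelihood y p / (\<integral>q. likelihood y q \<partial>normal_gamma m \<alpha> \<beta> \<nu>)))"

text \<open>
  The divergence, in nats, of a distribution \<open>P\<close> (in the sequel a posterior) from a normal-gamma
  prior. In \<^const>\<open>KL_divergence\<close> the reference measure comes first, so this is the integral over
  \<open>P\<close> of the logarithm of the density of \<open>P\<close> relative to the prior.
\<close>

definition K :: "(real \<times> real) measure \<Rightarrow> real \<Rightarrow> real \<Rightarrow> real \<Rightarrow> real \<Rightarrow> real" where
  "K P m \<alpha> \<beta> \<nu> = KL_divergence (exp 1) (normal_gamma m \<alpha> \<beta> \<nu>) P"

text \<open>
  The posterior is computed from the current value \<open>m\<close> and then held fixed; only the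
  prior's parameter \<open>m'\<close> is varied in the derivative.
\<close>

definition dK_dm :: "real \<Rightarrow> real \<Rightarrow> real \<Rightarrow> real \<Rightarrow> real \<Rightarrow> real" where
  "dK_dm y m \<alpha> \<beta> \<nu> = deriv (\<lambda>m'. K (posterior y m \<alpha> \<beta> \<nu>) m' \<alpha> \<beta> \<nu>) m"

definition m_dot :: "'a measure \<Rightarrow> ('a \<Rightarrow> real) \<Rightarrow> real \<Rightarrow> real \<Rightarrow> real \<Rightarrow> real \<Rightarrow> real" where
  "m_dot M Y m \<alpha> \<beta> \<nu> = - (\<integral>\<omega>. dK_dm (Y \<omega>) m \<alpha> \<beta> \<nu> \<partial>M)"

definition m_equilibrium :: "'a measure \<Rightarrow> ('a \<Rightarrow> real) \<Rightarrow> real \<Rightarrow> real \<Rightarrow> real \<Rightarrow> real \<Rightarrow> bool" where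
  "m_equilibrium M Y m \<alpha> \<beta> \<nu> \<longleftrightarrow> m_dot M Y m \<alpha> \<beta> \<nu> = 0"

end

theory Submission
  imports Defs
begin

text \<open>
  The normal-gamma family is conjugate to the normal likelihood, so the posterior is a normal-gamma
  distribution with explicit parameters (\<open>posterior_eq_normal_gamma\<close>), which the derivative in
  question holds fixed. The prior's mean parameter \<open>m\<close> enters the logarithm of the prior density
  only through \<open>- \<nu> * \<tau> * (x - m)\<^sup>2 / 2\<close>. Hence the divergence from the prior is a quadratic
  polynomial in \<open>m\<close>, with its minimum at the posterior mean parameter and with \<open>\<nu>\<close> times the
  posterior expectation of \<open>\<tau>\<close> as its second derivative (\<open>K_normal_gamma\<close>). Differentiating at the
  current \<open>m\<close> and inserting the posterior parameters gives
  \<open>(\<alpha> + 1 / 2) * (m - y) / (\<sigma> + (m - y)\<^sup>2 / 2)\<close> (\<open>K_posterior_has_derivative\<close>). This is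
  bounded in \<open>y\<close>, so its expectation exists, and it is the stated Gaussian integral.

  For the sign, put \<open>u = m - y\<close>: the integral pairs the odd function \<open>u / (\<sigma> + u\<^sup>2 / 2)\<close>, positive
  for \<open>u > 0\<close>, with a Gaussian centred at \<open>m - \<mu>\<close>. If \<open>m > \<mu>\<close>, that Gaussian gives more weight to
  each \<open>u > 0\<close> than to \<open>- u\<close>, so the integral is positive
  (\<open>integral_odd_times_shifted_gaussian_pos\<close>). Exchanging \<open>m\<close> and \<open>\<mu>\<close> changes its sign
  (\<open>score_integral_swap\<close>), which settles \<open>m < \<mu>\<close> and \<open>m = \<mu>\<close>.
\<close>

section \<open>Moments of the gamma density\<close>

definition gamma_density :: "real \<Rightarrow> real \<Rightarrow> real \<Rightarrow> real" where
  "gamma_density a b t =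
     (if t > 0 then b powr a / Gamma a * t powr (a - 1) * exp (- b * t) else 0)"

lemma borel_measurable_gamma_density [measurable]: "gamma_density a b \<in> borel_measurable borel"
  unfolding gamma_density_def [abs_def] by measurable

lemma gamma_density_pos: "\<lbrakk>0 < a; 0 < b; 0 < t\<rbrakk> \<Longrightarrow> 0 < gamma_density a b t"
  by (simp add: gamma_density_def Gamma_real_pos)

lemma gamma_density_nonpos: "t \<le> 0 \<Longrightarrow> gamma_density a b t = 0"
  by (simp add: gamma_density_def)

lemma gamma_density_nonneg: "\<lbrakk>0 < a; 0 < b\<rbrakk> \<Longrightarrow> 0 \<le> gamma_density a b t"
  by (simp add: gamma_density_def Gamma_real_pos less_imp_le)

text \<open>
  Rescaling by the rate turns the total mass into Euler's integral for \<^term>\<open>Gamma a\<close>.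
\<close>

lemma has_bochner_integral_gamma_density:
  assumes "0 < a" "0 < b"
  shows "has_bochner_integral lborel (gamma_density a b) 1"
proof (rule has_bochner_integral_nn_integral)
  let ?g = "\<lambda>t::real. indicator {0..} t * t powr (a - 1) / exp t"
  have G: "Gamma a > 0" using assms by (simp add: Gamma_real_pos)
  have eq: "gamma_density a b t = b / Gamma a * ?g (b * t)" for t
    using assms G
    by (cases "t > 0")
       (auto simp: gamma_density_def indicator_def powr_mult powr_diff exp_minus field_simps
         zero_le_mult_iff)
  have "ennreal (Gamma a) = (\<integral>\<^sup>+t. ennreal (?g t) \<partial>lborel)"
    using Gamma_conv_nn_integral_real [OF assms(1)] .
  also have "\<dots> = ennreal b * (\<integral>\<^sup>+t. ennreal (?g (b * t)) \<partial>lborel)"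
    using assms by (subst nn_integral_real_affine [where c = b and t = 0]) auto
  finally have *: "ennreal (Gamma a) = ennreal b * (\<integral>\<^sup>+t. ennreal (?g (b * t)) \<partial>lborel)" .
  have "(\<integral>\<^sup>+t. ennreal (gamma_density a b t) \<partial>lborel)
      = (\<integral>\<^sup>+t. ennreal (b / Gamma a) * ennreal (?g (b * t)) \<partial>lborel)"
    using assms G by (intro nn_integral_cong) (simp add: eq ennreal_mult' [symmetric])
  also have "\<dots> = ennreal (1 / Gamma a) * (ennreal b * (\<integral>\<^sup>+t. ennreal (?g (b * t)) \<partial>lborel))"
    using assms G
    by (subst nn_integral_cmult) (auto simp: mult.assoc [symmetric] ennreal_mult' [symmetric])
  also have "\<dots> = ennreal 1"
    using G by (simp add: * [symmetric] ennreal_mult' [symmetric] del: ennreal_1)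
  finally show "(\<integral>\<^sup>+t. ennreal (gamma_density a b t) \<partial>lborel) = ennreal 1" .
qed (use assms in \<open>auto simp: gamma_density_nonneg\<close>)

lemma has_bochner_integral_gamma_moment:
  assumes "0 < a" "0 < b" "0 < a + p"
  shows "has_bochner_integral lborel (\<lambda>t. gamma_density a b t * t powr p)
           (Gamma (a + p) / (Gamma a * b powr p))"
proof -
  let ?c = "Gamma (a + p) / (Gamma a * b powr p)"
  have G: "Gamma a > 0" "Gamma (a + p) > 0" using assms by (auto simp: Gamma_real_pos)
  \<comment> \<open>Multiplying by a power of \<open>t\<close> only shifts the shape parameter.\<close>
  have eq: "gamma_density a b t * t powr p = ?c * gamma_density (a + p) b t" for t
    using G
    by (cases "t > 0")
       (simp_all add: gamma_density_def powr_add powr_diff divide_simps del: Gamma_real_pos)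
  have "has_bochner_integral lborel (\<lambda>t. ?c * gamma_density (a + p) b t) (?c * 1)"
    using assms by (intro has_bochner_integral_mult_right has_bochner_integral_gamma_density)
  then show ?thesis by (simp add: eq)
qed

lemma gamma_mean:
  assumes "0 < a" "0 < b"
  shows "has_bochner_integral lborel (\<lambda>t. gamma_density a b t * t) (a / b)"
proof -
  have "Gamma (a + 1) = a * Gamma a"
    using assms by (intro Gamma_plus1) auto
  moreover have "Gamma a \<noteq> 0" using Gamma_real_pos [OF assms(1)] by simp
  moreover have "(\<lambda>t. gamma_density a b t * t powr 1) = (\<lambda>t. gamma_density a b t * t)"
    by (auto simp: gamma_density_def)
  \<comment> \<open>The restricted rewriting comes first because \<open>t powr 1\<close> would otherwise become \<open>\<bar>t\<bar>\<close>.\<close>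
  ultimately show ?thesis
    using has_bochner_integral_gamma_moment [of a b 1] assms by (simp only:) simp
qed

text \<open>
  Near \<open>0\<close> the logarithm is dominated by \<open>t powr (- a / 2)\<close>, an exponent small enough for the gamma
  density to absorb, and away from \<open>0\<close> it is dominated by \<open>t\<close>. The logarithm enters the divergence
  because the posterior shape parameter exceeds the prior one by \<open>1 / 2\<close>.
\<close>

lemma integrable_gamma_ln:
  assumes "0 < a" "0 < b"
  shows "integrable lborel (\<lambda>t. gamma_density a b t * ln t)"
proof (rule Bochner_Integration.integrable_bound)
  let ?h = "\<lambda>t. gamma_density a b t * t + 2 / a * (gamma_density a b t * t powr (- a / 2))"
  show "integrable lborel ?h"
    using gamma_mean [OF assms] has_bochner_integral_gamma_moment [of a b "- a / 2"] assms
    by (auto dest!: integrable.intros)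
  have "\<bar>gamma_density a b t * ln t\<bar> \<le> ?h t" for t
  proof (cases "t > 0")
    case True
    have "ln t \<le> t" using True ln_bound by blast
    moreover have "- ln t = 2 / a * ln (t powr (- a / 2))"
      using True assms by (simp add: ln_powr field_simps)
    moreover have "ln (t powr (- a / 2)) \<le> t powr (- a / 2)"
      using True by (intro ln_bound) auto
    ultimately have "- ln t \<le> 2 / a * t powr (- a / 2)"
      using mult_left_mono [of _ _ "2 / a"] assms by (metis divide_nonneg_pos less_imp_le zero_le_numeral)
    moreover have "0 \<le> 2 / a * t powr (- a / 2)" using assms by simp
    ultimately have "\<bar>ln t\<bar> \<le> t + 2 / a * t powr (- a / 2)"
      using True \<open>ln t \<le> t\<close> by linarith
    from mult_left_mono [OF this gamma_density_nonneg [OF assms, of t]] show ?thesis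
      using gamma_density_nonneg [OF assms, of t] by (simp add: abs_mult algebra_simps)
  qed (simp add: gamma_density_nonpos)
  then show "AE t in lborel. norm (gamma_density a b t * ln t) \<le> norm (?h t)"
    using abs_ge_self order_trans by (fastforce simp del: abs_mult)
qed auto

section \<open>Moments of the normal-gamma distribution\<close>

text \<open>
  Fubini with the first coordinate integrated first: for the normal-gamma density the mean coordinate
  is normal given the precision, so every inner integral below is a known normal moment.
\<close>

lemma has_bochner_integral_iterated_snd:
  fixes f :: "real \<times> real \<Rightarrow> real"
  assumes [measurable]: "f \<in> borel_measurable borel"
    and inner: "\<And>t. has_bochner_integral lborel (\<lambda>x. f (x, t)) (g t)"
    and abs: "\<And>t. has_bochner_integral lborel (\<lambda>x. \<bar>f (x, t)\<bar>) (h t)"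
    and g: "has_bochner_integral lborel g I" and h: "integrable lborel h"
  shows "has_bochner_integral lborel f I"
proof -
  have m: "f \<in> borel_measurable (lborel \<Otimes>\<^sub>M lborel)"
    by (simp add: lborel_prod)
  have *: "integrable (lborel \<Otimes>\<^sub>M lborel) (\<lambda>(t, x). f (x, t))"
  proof (rule lborel_pair.Fubini_integrable)
    show "(\<lambda>(t, x). f (x, t)) \<in> borel_measurable (lborel \<Otimes>\<^sub>M lborel)"
      using measurable_pair_swap [OF m] by simp
    show "integrable lborel (\<lambda>t. \<integral>x. norm (case (t, x) of (t, x) \<Rightarrow> f (x, t)) \<partial>lborel)"
      using h has_bochner_integral_integral_eq [OF abs] by simp
    show "AE t in lborel. integrable lborel (\<lambda>x. case (t, x) of (t, x) \<Rightarrow> f (x, t))"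
      using inner by (auto intro: integrable.intros)
  qed
  then have int: "integrable (lborel \<Otimes>\<^sub>M lborel) f"
    using lborel_pair.integrable_product_swap_iff [of f] by simp
  have "integral\<^sup>L (lborel \<Otimes>\<^sub>M lborel) f = (\<integral>t. (\<integral>x. f (x, t) \<partial>lborel) \<partial>lborel)"
    using lborel_pair.integral_snd [of "\<lambda>x t. f (x, t)"] int by simp
  also have "\<dots> = I"
    using has_bochner_integral_integral_eq [OF inner] g by (simp add: has_bochner_integral_integral_eq)
  finally show ?thesis
    using int by (simp add: has_bochner_integral_iff lborel_prod)
qed

lemma normal_gamma_density_eq:
  "normal_gamma_density m a b n (x, t) = gamma_density a b t * normal_density m (1 / sqrt (n * t)) x"
  by (simp add: normal_gamma_density_def gamma_density_def)

lemma borel_measurable_normal_gamma_density [measurable]: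
  "normal_gamma_density m a b n \<in> borel_measurable (borel \<Otimes>\<^sub>M borel)"
proof -
  have "normal_gamma_density m a b n = (\<lambda>p. gamma_density a b (snd p) *
     (1 / sqrt (2 * pi * (1 / sqrt (n * snd p))\<^sup>2) *
      exp (- (fst p - m)\<^sup>2 / (2 * (1 / sqrt (n * snd p))\<^sup>2))))"
    by (auto simp: normal_gamma_density_eq normal_density_def)
  also have "\<dots> \<in> borel_measurable (borel \<Otimes>\<^sub>M borel)" by measurable
  finally show ?thesis .
qed

text \<open>
  Given \<open>t\<close>, the even central moment of \<open>x\<close> is a constant times \<open>(n * t) ^ - k\<close>, so the expectation
  of \<open>h t * (x - m) ^ (2 * k)\<close> reduces to a gamma expectation of \<open>h t / t ^ k\<close>.
\<close>

lemma normal_gamma_even_moment: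
  assumes "0 < a" "0 < b" "0 < n" and [measurable]: "h \<in> borel_measurable borel"
    and h: "has_bochner_integral lborel (\<lambda>t. gamma_density a b t * (h t / t ^ k)) I"
  shows "has_bochner_integral lborel
           (\<lambda>p. normal_gamma_density m a b n p * (h (snd p) * (fst p - m) ^ (2 * k)))
           (fact (2 * k) / ((2 * n) ^ k * fact k) * I)"
proof -
  let ?c = "fact (2 * k) / ((2 * n) ^ k * fact k) :: real"
  have inner: "has_bochner_integral lborel
      (\<lambda>x. normal_gamma_density m a b n (x, t) * (r * (x - m) ^ (2 * k)))
      (?c * (gamma_density a b t * (r / t ^ k)))" for r t
  proof (cases "t > 0")
    case True
    have "has_bochner_integral lborel
        (\<lambda>x. (gamma_density a b t * r) *
              (normal_density m (1 / sqrt (n * t)) x * (x - m) ^ (2 * k)))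
        ((gamma_density a b t * r) * (fact (2 * k) / ((2 / (1 / sqrt (n * t))\<^sup>2) ^ k * fact k)))"
      using True assms by (intro has_bochner_integral_mult_right normal_moment_even) auto
    moreover have "(gamma_density a b t * r) * (fact (2 * k) / ((2 / (1 / sqrt (n * t))\<^sup>2) ^ k * fact k))
        = ?c * (gamma_density a b t * (r / t ^ k))"
      using True assms by (simp add: power_divide power_mult_distrib ac_simps)
    ultimately show ?thesis
      by (simp add: normal_gamma_density_eq mult.assoc mult.left_commute)
  qed (simp add: normal_gamma_density_eq gamma_density_nonpos has_bochner_integral_zero)
  have nn: "0 \<le> normal_gamma_density m a b n p" for p
    using assms by (cases p) (simp add: normal_gamma_density_eq gamma_density_nonneg)
  show ?thesis
  proof (rule has_bochner_integral_iterated_snd)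
    show "(\<lambda>p. normal_gamma_density m a b n p * (h (snd p) * (fst p - m) ^ (2 * k)))
        \<in> borel_measurable borel"
      by (simp add: borel_prod [symmetric])
    show "has_bochner_integral lborel
        (\<lambda>x. normal_gamma_density m a b n (x, t) * (h (snd (x, t)) * (fst (x, t) - m) ^ (2 * k)))
        (?c * (gamma_density a b t * (h t / t ^ k)))" for t
      using inner by simp
    show "has_bochner_integral lborel
        (\<lambda>x. \<bar>normal_gamma_density m a b n (x, t) * (h (snd (x, t)) * (fst (x, t) - m) ^ (2 * k))\<bar>)
        (?c * (gamma_density a b t * (\<bar>h t\<bar> / t ^ k)))" for t
      using inner [of t "\<bar>h t\<bar>"] nn by (simp add: abs_mult power_mult)
    show "has_bochner_integral lborel (\<lambda>t. ?c * (gamma_density a b t * (h t / t ^ k))) (?c * I)"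
      using h by (rule has_bochner_integral_mult_right)
    have "integrable lborel (\<lambda>t. \<bar>gamma_density a b t * (h t / t ^ k)\<bar>)"
      using h by (intro integrable_abs integrable.intros)
    moreover have "\<bar>gamma_density a b t * (h t / t ^ k)\<bar> = gamma_density a b t * (\<bar>h t\<bar> / t ^ k)" for t
      using assms by (cases "t > 0") (auto simp: abs_mult gamma_density_nonneg gamma_density_nonpos)
    ultimately have "integrable lborel (\<lambda>t. gamma_density a b t * (\<bar>h t\<bar> / t ^ k))"
      by (simp only:)
    then show "integrable lborel (\<lambda>t. ?c * (gamma_density a b t * (\<bar>h t\<bar> / t ^ k)))"
      by (rule integrable_mult_right)
  qed
qed

text \<open>
  The inner integral is a vanishing odd moment. Absolute integrability must be checked separately:
  the first absolute moment of \<open>x - m\<close> given \<open>t\<close> is proportional to \<open>1 / sqrt t\<close>, which leaves a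
  gamma moment of order \<open>1 / 2\<close>.
\<close>

lemma normal_gamma_cross_moment:
  assumes "0 < a" "0 < b" "0 < n"
  shows "has_bochner_integral lborel
           (\<lambda>p. normal_gamma_density m a b n p * (snd p * (fst p - m))) 0"
proof (rule has_bochner_integral_iterated_snd)
  show "(\<lambda>p. normal_gamma_density m a b n p * (snd p * (fst p - m))) \<in> borel_measurable borel"
    by (simp add: borel_prod [symmetric])
  show "has_bochner_integral lborel
      (\<lambda>x. normal_gamma_density m a b n (x, t) * (snd (x, t) * (fst (x, t) - m))) 0" for t
  proof (cases "t > 0")
    case True
    have "has_bochner_integral lborel
        (\<lambda>x. (gamma_density a b t * t) *
              (normal_density m (1 / sqrt (n * t)) x * (x - m) ^ (2 * 0 + 1)))
        ((gamma_density a b t * t) * 0)"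
      using True assms by (intro has_bochner_integral_mult_right normal_moment_odd) auto
    then show ?thesis
      by (simp add: normal_gamma_density_eq mult.assoc mult.left_commute)
  qed (simp add: normal_gamma_density_eq gamma_density_nonpos has_bochner_integral_zero)
  let ?c = "sqrt (2 / pi) / sqrt n"
  show "has_bochner_integral lborel
      (\<lambda>x. \<bar>normal_gamma_density m a b n (x, t) * (snd (x, t) * (fst (x, t) - m))\<bar>)
      (?c * (gamma_density a b t * t powr (1/2)))" for t
  proof (cases "t > 0")
    case True
    have "has_bochner_integral lborel
        (\<lambda>x. (gamma_density a b t * t) *
              (normal_density m (1 / sqrt (n * t)) x * \<bar>x - m\<bar> ^ (2 * 0 + 1)))
        ((gamma_density a b t * t) *
           (2 ^ 0 * (1 / sqrt (n * t)) ^ (2 * 0 + 1) * fact 0 * sqrt (2 / pi)))"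
      using True assms by (intro has_bochner_integral_mult_right normal_moment_abs_odd) auto
    moreover have "(gamma_density a b t * t) *
           (2 ^ 0 * (1 / sqrt (n * t)) ^ (2 * 0 + 1) * fact 0 * sqrt (2 / pi))
         = ?c * (gamma_density a b t * t powr (1/2))"
      using True assms real_div_sqrt [of t]
      by (simp add: powr_half_sqrt real_sqrt_mult field_simps)
    ultimately show ?thesis
      using True assms gamma_density_nonneg [of a b t]
      by (simp add: normal_gamma_density_eq mult.assoc mult.left_commute abs_mult)
  qed (simp add: normal_gamma_density_eq gamma_density_nonpos has_bochner_integral_zero)
  show "integrable lborel (\<lambda>t. ?c * (gamma_density a b t * t powr (1/2)))"
    using has_bochner_integral_gamma_moment [of a b "1/2"] assms
    by (auto intro!: integrable.intros integrable_mult_right)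
qed (simp add: has_bochner_integral_zero)

section \<open>Conjugacy\<close>

lemma normal_density_precision:
  assumes "0 < t"
  shows "normal_density m (1 / sqrt t) x = sqrt (t / (2 * pi)) * exp (- (t * (x - m)\<^sup>2 / 2))"
  using assms by (simp add: normal_density_def power_divide real_sqrt_divide real_sqrt_mult)

lemma normal_gamma_density_pos:
  assumes "0 < a" "0 < b" "0 < n" "0 < t"
  shows "0 < normal_gamma_density m a b n (x, t)"
  using assms by (simp add: normal_gamma_density_eq gamma_density_pos normal_density_pos)

lemma normal_gamma_density_nonpos: "t \<le> 0 \<Longrightarrow> normal_gamma_density m a b n (x, t) = 0"
  by (simp add: normal_gamma_density_eq gamma_density_nonpos)

lemma normal_gamma_density_nonneg:
  assumes "0 < a" "0 < b"
  shows "0 \<le> normal_gamma_density m a b n p"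
  using assms by (cases p) (simp add: normal_gamma_density_eq gamma_density_nonneg)

lemma has_bochner_integral_normal_gamma_density:
  assumes "0 < a" "0 < b" "0 < n"
  shows "has_bochner_integral lborel (normal_gamma_density m a b n) 1"
  using normal_gamma_even_moment [OF assms, of "\<lambda>_. 1" 0 1 m]
    has_bochner_integral_gamma_density [OF assms(1,2)] by simp

text \<open>
  Completing the square in \<open>x\<close>; half the remainder is what the observation adds to the rate.
\<close>

lemma sum_of_two_quadratics:
  fixes m n x y :: real
  assumes "0 < n"
  shows "n * (x - m)\<^sup>2 + (x - y)\<^sup>2
    = (n + 1) * (x - (n * m + y) / (n + 1))\<^sup>2 + n * (y - m)\<^sup>2 / (n + 1)"
  using assms by (simp add: divide_simps) (simp add: power2_eq_square algebra_simps)

text \<open>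
  Conjugacy: once the two quadratics in the exponent are merged, the product is again a normal-gamma
  density up to a factor \<open>Z\<close> that depends on neither coordinate. Since normal-gamma densities have
  total mass \<open>1\<close>, \<open>Z\<close> is the evidence by which Bayes' rule divides.
\<close>

lemma likelihood_times_normal_gamma_density:
  fixes a b m n y :: real
  assumes "0 < a" "0 < b" "0 < n"
  defines "B \<equiv> b + n * (y - m)\<^sup>2 / (2 * (n + 1))"
  shows "\<exists>Z > 0. \<forall>p. normal_gamma_density m a b n p * likelihood y p
           = Z * normal_gamma_density ((n * m + y) / (n + 1)) (a + 1/2) B (n + 1) p"
proof -
  let ?Z = "b powr a * Gamma (a + 1/2) * sqrt (n / (n + 1)) /
            (Gamma a * B powr (a + 1/2) * sqrt (2 * pi))"
  have B: "0 < B" using assms by (simp add: B_def add_pos_nonneg)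
  have G: "0 < Gamma a" "0 < Gamma (a + 1/2)" using assms by (auto intro: Gamma_real_pos)
  have "normal_gamma_density m a b n (x, t) * likelihood y (x, t)
      = ?Z * normal_gamma_density ((n * m + y) / (n + 1)) (a + 1/2) B (n + 1) (x, t)" for x t
  proof (cases "0 < t")
    case True
    have e: "exp (- b * t) * exp (- (n * t * (x - m)\<^sup>2 / 2)) * exp (- (t * (y - x)\<^sup>2 / 2))
       = exp (- B * t) * exp (- ((n + 1) * t * (x - (n * m + y) / (n + 1))\<^sup>2 / 2))"
    proof -
      have "- b * t - n * t * (x - m)\<^sup>2 / 2 - t * (y - x)\<^sup>2 / 2
          = - b * t - t / 2 * (n * (x - m)\<^sup>2 + (x - y)\<^sup>2)"
        by (simp add: algebra_simps power2_commute [of y x])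
      also have "\<dots> = - B * t - (n + 1) * t * (x - (n * m + y) / (n + 1))\<^sup>2 / 2"
      proof -
        have "- b * t - t / 2 * ((n + 1) * X + n * W / (n + 1))
            = - (b + n * W / (2 * (n + 1))) * t - (n + 1) * t * X / 2" for X W
          using assms(3) by (simp add: field_simps)
        then show ?thesis
          unfolding sum_of_two_quadratics [OF assms(3)] B_def .
      qed
      finally show ?thesis by (simp add: exp_add [symmetric] exp_diff [symmetric] del: exp_diff)
    qed
    have s: "sqrt (n * t / (2 * pi)) * sqrt (t / (2 * pi)) * t powr (a - 1)
       = sqrt (n / (n + 1)) / sqrt (2 * pi) * (t powr (a + 1/2 - 1) * sqrt ((n + 1) * t / (2 * pi)))"
    proof -
      have "t powr (a + 1/2 - 1) = t powr (a - 1) * sqrt t"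
        using True by (simp add: powr_half_sqrt [symmetric] powr_add [symmetric])
      then show ?thesis
        using assms True by (simp add: real_sqrt_divide real_sqrt_mult)
    qed
    have "normal_gamma_density m a b n (x, t) * likelihood y (x, t)
       = b powr a / Gamma a * (sqrt (n * t / (2 * pi)) * sqrt (t / (2 * pi)) * t powr (a - 1)) *
         (exp (- b * t) * exp (- (n * t * (x - m)\<^sup>2 / 2)) * exp (- (t * (y - x)\<^sup>2 / 2)))"
      using True assms
      by (simp add: normal_gamma_density_eq gamma_density_def likelihood_def normal_density_precision)
    also have "\<dots> = ?Z * normal_gamma_density ((n * m + y) / (n + 1)) (a + 1/2) B (n + 1) (x, t)"
      unfolding e s using True assms(3) B G
      by (simp add: normal_gamma_density_eq gamma_density_def normal_density_precision)
    finally show ?thesis .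
  qed (simp add: normal_gamma_density_nonpos)
  moreover have "0 < ?Z" using assms B G by simp
  ultimately show ?thesis by (metis surj_pair)
qed

lemma borel_measurable_likelihood [measurable]:
  "likelihood y \<in> borel_measurable (borel \<Otimes>\<^sub>M borel)"
proof -
  have "likelihood y = (\<lambda>p. 1 / sqrt (2 * pi * (1 / sqrt (snd p))\<^sup>2) *
      exp (- (y - fst p)\<^sup>2 / (2 * (1 / sqrt (snd p))\<^sup>2)))"
    by (auto simp: likelihood_def normal_density_def)
  also have "\<dots> \<in> borel_measurable (borel \<Otimes>\<^sub>M borel)" by measurable
  finally show ?thesis .
qed

lemma posterior_eq_normal_gamma:
  assumes "0 < a" "0 < b" "0 < n"
  shows "posterior y m a b n =
    normal_gamma ((n * m + y) / (n + 1)) (a + 1/2) (b + n * (y - m)\<^sup>2 / (2 * (n + 1))) (n + 1)"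
proof -
  let ?B = "b + n * (y - m)\<^sup>2 / (2 * (n + 1))"
  let ?p = "normal_gamma_density m a b n"
  let ?q = "normal_gamma_density ((n * m + y) / (n + 1)) (a + 1/2) ?B (n + 1)"
  obtain Z where Z: "0 < Z" "\<And>p. ?p p * likelihood y p = Z * ?q p"
    using likelihood_times_normal_gamma_density [OF assms, of m y] by blast
  have B: "0 < ?B" using assms by (simp add: add_pos_nonneg)
  have [measurable]: "?p \<in> borel_measurable lborel" "?q \<in> borel_measurable lborel"
    "likelihood y \<in> borel_measurable lborel"
    by (simp_all add: borel_prod [symmetric])
  have "(\<integral>q. likelihood y q \<partial>normal_gamma m a b n) = (\<integral>q. ?p q * likelihood y q \<partial>lborel)"
    unfolding normal_gamma_def using assms
    by (subst integral_real_density) (auto simp: normal_gamma_density_nonneg)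
  also have "\<dots> = Z * (\<integral>q. ?q q \<partial>lborel)" by (simp add: Z)
  also have "(\<integral>q. ?q q \<partial>lborel) = 1"
    using has_bochner_integral_normal_gamma_density [of "a + 1/2" ?B "n + 1"] assms B
    by (simp add: has_bochner_integral_integral_eq)
  finally have evidence: "(\<integral>q. likelihood y q \<partial>normal_gamma m a b n) = Z" by simp
  have "ennreal (?p p) * ennreal (likelihood y p / Z) = ennreal (?q p)" for p
  proof -
    have "ennreal (?p p) * ennreal (likelihood y p / Z) = ennreal (?p p * (likelihood y p / Z))"
      using assms by (intro ennreal_mult' [symmetric] normal_gamma_density_nonneg)
    also have "?p p * (likelihood y p / Z) = ?q p" using Z by simp
    finally show ?thesis .
  qed
  then show ?thesis
    unfolding posterior_def evidence unfolding normal_gamma_def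
    by (subst density_density_eq) simp_all
qed

section \<open>The divergence as a function of the prior mean parameter\<close>

lemma ln_normal_gamma_density:
  assumes "0 < a" "0 < b" "0 < n" "0 < t"
  shows "ln (normal_gamma_density m a b n (x, t)) =
    ln (b powr a / Gamma a) + (a - 1) * ln t - b * t + (ln n + ln t - ln (2 * pi)) / 2
      - n * t * (x - m)\<^sup>2 / 2"
proof -
  let ?G = "b powr a / Gamma a"
  have G: "0 < ?G" using assms by simp
  have "normal_gamma_density m a b n (x, t) =
      ?G * (t powr (a - 1) * (exp (- b * t) * (sqrt (n * t / (2 * pi)) * exp (- (n * t * (x - m)\<^sup>2 / 2)))))"
    using assms by (simp add: normal_gamma_density_eq gamma_density_def normal_density_precision)
  moreover have "ln (\<dots>) = ln ?G + (a - 1) * ln t - b * t + ln (n * t / (2 * pi)) / 2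
      - n * t * (x - m)\<^sup>2 / 2"
    using assms G by (subst ln_mult_pos; simp add: ln_mult_pos ln_sqrt ln_powr del: times_divide_eq_left)+
  moreover have "ln (n * t / (2 * pi)) = ln n + ln t - ln (2 * pi)"
    using assms by (simp add: ln_div ln_mult_pos)
  ultimately show ?thesis by simp
qed

text \<open>
  The log-ratio of the two densities is a linear combination of \<open>1\<close>, \<open>ln t\<close>, \<open>t\<close>,
  \<open>t * (x - m1)\<^sup>2\<close> and \<open>t * (x - m)\<^sup>2\<close>, and only the last term involves \<open>m\<close>.
  After expansion about \<open>m1\<close> the cross term vanishes in expectation, and \<open>a1 / b1\<close> is the mean of
  \<open>t\<close>. All the moments must be finite, those in the constant \<open>C\<close> included: a divergent Bochner
  integral has the value \<open>0\<close>, which would hide the dependence on \<open>m\<close>.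
\<close>

lemma K_normal_gamma:
  assumes pos: "0 < a1" "0 < b1" "0 < n1" "0 < a" "0 < b" "0 < n"
  shows "\<exists>C. \<forall>m. K (normal_gamma m1 a1 b1 n1) m a b n = C + n * a1 / (2 * b1) * (m - m1)\<^sup>2"
proof -
  let ?q = "normal_gamma_density m1 a1 b1 n1"
  let ?g = "\<lambda>t. gamma_density a1 b1 t"
  define c where "c = ln (b1 powr a1 / Gamma a1) - ln (b powr a / Gamma a) + (ln n1 - ln n) / 2"
  define L where "L = integral\<^sup>L lborel (\<lambda>t. ?g t * ln t)"
  have I1: "has_bochner_integral lborel ?q 1"
    using pos by (intro has_bochner_integral_normal_gamma_density)
  have I2: "has_bochner_integral lborel (\<lambda>p. ?q p * ln (snd p)) L"
    using normal_gamma_even_moment [OF pos(1-3), of ln 0 L m1] integrable_gamma_ln [OF pos(1,2)]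
    by (simp add: L_def has_bochner_integral_iff)
  have I3: "has_bochner_integral lborel (\<lambda>p. ?q p * snd p) (a1 / b1)"
    using normal_gamma_even_moment [OF pos(1-3), of "\<lambda>t. t" 0 "a1 / b1" m1] gamma_mean [OF pos(1,2)]
    by simp
  have I4: "has_bochner_integral lborel (\<lambda>p. ?q p * (snd p * (fst p - m1)\<^sup>2)) (1 / n1)"
  proof -
    \<comment> \<open>The factor \<open>t / t\<close> is \<open>0\<close> at \<open>t = 0\<close>, where the density vanishes as well.\<close>
    have "(\<lambda>t. ?g t * (t / t ^ 1)) = ?g"
      by (auto simp: gamma_density_def)
    then show ?thesis
      using normal_gamma_even_moment [OF pos(1-3), of "\<lambda>t. t" 1 1 m1]
        has_bochner_integral_gamma_density [OF pos(1,2)]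
      by (simp add: fact_numeral)
  qed
  have I5: "has_bochner_integral lborel (\<lambda>p. ?q p * (snd p * (fst p - m1))) 0"
    using pos(1-3) by (rule normal_gamma_cross_moment)
  have "K (normal_gamma m1 a1 b1 n1) m a b n
      = (c + (a1 - a) * L - (b1 - b) * (a1 / b1) + (n - n1) / 2 * (1 / n1))
        + n * a1 / (2 * b1) * (m - m1)\<^sup>2" for m
  proof -
    let ?p = "normal_gamma_density m a b n"
    have [measurable]: "?p \<in> borel_measurable lborel" "?q \<in> borel_measurable lborel"
      by (simp_all add: borel_prod [symmetric])
    have zero: "?p p = 0 \<longrightarrow> ?q p = 0" for p
      using normal_gamma_density_pos [OF pos(4-6)] normal_gamma_density_nonpos
      by (cases p) (metis less_irrefl not_le)
    have "K (normal_gamma m1 a1 b1 n1) m a b n = (\<integral>p. ?q p * log (exp 1) (?q p / ?p p) \<partial>lborel)"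
      unfolding K_def normal_gamma_def using pos zero
      by (intro lborel.KL_density_density) (auto simp: normal_gamma_density_nonneg)
    also have "\<dots> = (\<integral>p. c * ?q p + (a1 - a) * (?q p * ln (snd p)) - (b1 - b) * (?q p * snd p)
         + (n - n1) / 2 * (?q p * (snd p * (fst p - m1)\<^sup>2))
         + n * (m1 - m) * (?q p * (snd p * (fst p - m1)))
         + n / 2 * (m - m1)\<^sup>2 * (?q p * snd p) \<partial>lborel)"
    proof (rule Bochner_Integration.integral_cong [OF refl])
      fix p :: "real \<times> real"
      obtain x t where p: "p = (x, t)" by (cases p)
      show "?q p * log (exp 1) (?q p / ?p p) =
         c * ?q p + (a1 - a) * (?q p * ln (snd p)) - (b1 - b) * (?q p * snd p)
         + (n - n1) / 2 * (?q p * (snd p * (fst p - m1)\<^sup>2))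
         + n * (m1 - m) * (?q p * (snd p * (fst p - m1)))
         + n / 2 * (m - m1)\<^sup>2 * (?q p * snd p)"
      proof (cases "0 < t")
        case True
        have "log (exp 1) (?q p / ?p p) = ln (?q (x, t)) - ln (?p (x, t))"
          using normal_gamma_density_pos [OF pos(4-6) True, of m x]
            normal_gamma_density_pos [OF pos(1-3) True, of m1 x]
          by (simp add: p log_def ln_div)
        also have "\<dots> = c + (a1 - a) * ln t - (b1 - b) * t + (n - n1) / 2 * (t * (x - m1)\<^sup>2)
            + n * (m1 - m) * (t * (x - m1)) + n / 2 * (m - m1)\<^sup>2 * t"
          unfolding ln_normal_gamma_density [OF pos(1-3) True] ln_normal_gamma_density [OF pos(4-6) True]
            c_def by (simp add: field_simps) (simp add: power2_eq_square algebra_simps)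
        finally have log: "log (exp 1) (?q p / ?p p) = \<dots>" .
        show ?thesis unfolding log unfolding p fst_conv snd_conv by (simp add: algebra_simps)
      qed (simp add: p normal_gamma_density_nonpos)
    qed
    also have "\<dots> = c * 1 + (a1 - a) * L - (b1 - b) * (a1 / b1) + (n - n1) / 2 * (1 / n1)
         + n * (m1 - m) * 0 + n / 2 * (m - m1)\<^sup>2 * (a1 / b1)"
      by (intro has_bochner_integral_integral_eq has_bochner_integral_add has_bochner_integral_diff
            has_bochner_integral_mult_right I1 I2 I3 I4 I5)
    finally show ?thesis by simp
  qed
  then show ?thesis by blast
qed

text \<open>
  By the preceding quadratic formula the derivative is \<open>n * (a' / b') * (m - m')\<close>, with the posterior
  parameters \<open>m'\<close>, \<open>a'\<close> and \<open>b'\<close>. Here \<open>m - m' = (m - y) / (n + 1)\<close>, and dividing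
  \<open>b'\<close> by \<open>n / (n + 1)\<close> gives \<open>b * (n + 1) / n + (m - y)\<^sup>2 / 2\<close>.
\<close>

lemma K_posterior_has_derivative:
  assumes pos: "0 < a" "0 < b" "0 < n"
  shows "((\<lambda>m'. K (posterior y m a b n) m' a b n) has_real_derivative
           (a + 1/2) * ((m - y) / (b * (n + 1) / n + (m - y)\<^sup>2 / 2))) (at m)"
proof -
  let ?B = "b + n * (y - m)\<^sup>2 / (2 * (n + 1))"
  let ?m = "(n * m + y) / (n + 1)"
  have B: "0 < ?B" using assms by (simp add: add_pos_nonneg)
  obtain C where C: "\<And>m'. K (posterior y m a b n) m' a b n
      = C + n * (a + 1/2) / (2 * ?B) * (m' - ?m)\<^sup>2"
    using K_normal_gamma [of "a + 1/2" ?B "n + 1" a b n ?m] pos B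
    unfolding posterior_eq_normal_gamma [OF pos] by auto
  have "((\<lambda>m'. C + c * (m' - e)\<^sup>2) has_real_derivative c * (2 * (m - e))) (at m)" for c e
    by (auto intro!: derivative_eq_intros)
  then have "((\<lambda>m'. C + n * (a + 1/2) / (2 * ?B) * (m' - ?m)\<^sup>2) has_real_derivative
      n * (a + 1/2) / (2 * ?B) * (2 * (m - ?m))) (at m)" .
  also have "n * (a + 1/2) / (2 * ?B) * (2 * (m - ?m))
      = (a + 1/2) * ((m - y) / (b * (n + 1) / n + (m - y)\<^sup>2 / 2))"
  proof -
    have shift: "m - ?m = (m - y) / (n + 1)"
      using pos by (simp add: field_simps)
    have "n * A / (2 * B) * (2 * (X / N)) = A * (X / (N / n * B))" for A B X N
      using pos by (simp add: ac_simps)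
    then have "n * (a + 1/2) / (2 * ?B) * (2 * (m - ?m)) = (a + 1/2) * ((m - y) / ((n + 1) / n * ?B))"
      unfolding shift .
    also have "(n + 1) / n * ?B = b * (n + 1) / n + (m - y)\<^sup>2 / 2"
    proof -
      have cancel: "N / n * (b + n * W / (2 * N)) = b * N / n + W / 2" if "N \<noteq> 0" for N W
        using pos that by (simp add: field_simps)
      show ?thesis
        unfolding power2_commute [of m y] by (rule cancel) (use pos in simp)
    qed
    finally show ?thesis .
  qed
  finally show ?thesis unfolding C .
qed

section \<open>The sign of the averaged derivative\<close>

text \<open>
  Adding to the integral its image under \<open>u \<mapsto> - u\<close> replaces the weight by the difference of the
  Gaussians centred at \<open>d\<close> and at \<open>- d\<close>. This difference is odd and positive for \<open>u > 0\<close>,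
  like \<open>g\<close>, so the resulting integrand is positive except at \<open>0\<close>.
\<close>

lemma integral_odd_times_shifted_gaussian_pos:
  fixes g :: "real \<Rightarrow> real" and d V :: real
  assumes [measurable]: "g \<in> borel_measurable borel"
    and odd: "\<And>u. g (- u) = - g u" and pos: "\<And>u. 0 < u \<Longrightarrow> 0 < g u"
    and int: "\<And>d. integrable lborel (\<lambda>u. g u * exp (- ((u - d)\<^sup>2 / (2 * V))))"
    and "0 < d" "0 < V"
  shows "0 < (\<integral>u. g u * exp (- ((u - d)\<^sup>2 / (2 * V))) \<partial>lborel)" (is "0 < ?I")
proof -
  let ?e = "\<lambda>d u. exp (- ((u - d)\<^sup>2 / (2 * V)))"
  let ?f = "\<lambda>u. g u * ?e d u - g u * ?e (- d) u"
  have "?I = (\<integral>u. g (- u) * ?e d (- u) \<partial>lborel)"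
    using lborel_integral_real_affine [of "-1" "\<lambda>u. g u * ?e d u" 0] by simp
  also have "\<dots> = (\<integral>u. - (g u * ?e (- d) u) \<partial>lborel)"
    by (intro Bochner_Integration.integral_cong) (simp_all add: odd power2_eq_square algebra_simps)
  finally have "2 * ?I = ?I - (\<integral>u. g u * ?e (- d) u \<partial>lborel)" by simp
  also have "\<dots> = integral\<^sup>L lborel ?f" using int [of d] int [of "- d"] by simp
  finally have I: "2 * ?I = integral\<^sup>L lborel ?f" .
  have fpos: "0 < ?f u" if "0 < u" for u
  proof -
    have "(u - d)\<^sup>2 < (u + d)\<^sup>2"
      using that \<open>0 < d\<close> by (simp add: power2_eq_square algebra_simps)
    then have "?e (- d) u < ?e d u" using \<open>0 < V\<close> by (simp add: divide_strict_right_mono)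
    then show ?thesis using pos [OF that] by simp
  qed
  have even: "?f (- u) = ?f u" for u
    by (simp add: odd power2_eq_square algebra_simps)
  have f_pos: "0 < ?f u" if "u \<noteq> 0" for u
    using fpos [of u] fpos [of "- u"] even [of u] that by (cases "0 < u") auto
  have "g 0 = 0" using odd [of 0] by simp
  then have f_nonneg: "0 \<le> ?f u" for u
    using f_pos [of u] by (cases "u = 0") auto
  have intf: "integrable lborel ?f" using int [of d] int [of "- d"] by simp
  have "integral\<^sup>L lborel ?f \<noteq> 0"
  proof
    assume "integral\<^sup>L lborel ?f = 0"
    then have "AE u in lborel. ?f u = 0"
      using integral_nonneg_eq_0_iff_AE [OF intf] f_nonneg by simp
    moreover have "AE u in lborel. u \<noteq> (0::real)" by (rule AE_lborel_singleton)
    ultimately have "AE u in (lborel :: real measure). False"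
      by eventually_elim (use f_pos in \<open>fastforce\<close>)
    then show False by (simp add: eventually_False ae_filter_eq_bot_iff)
  qed
  moreover have "0 \<le> integral\<^sup>L lborel ?f" using f_nonneg by simp
  ultimately show ?thesis using I by linarith
qed

text \<open>
  The quotient is the derivative of \<open>ln (s + u\<^sup>2 / 2)\<close>, the score of a Student location family. Its
  boundedness gives every integrability claim about the observation; the bound is not sharp.
\<close>

lemma abs_score_le:
  fixes s u :: real
  assumes "0 < s"
  shows "\<bar>u / (s + u\<^sup>2 / 2)\<bar> \<le> 1 / s + 2"
proof -
  have "\<bar>u\<bar> \<le> 1 + u\<^sup>2"
    using zero_le_power2 [of "\<bar>u\<bar> - 1"] by (simp add: power2_diff)
  also have "\<dots> \<le> (1 / s + 2) * (s + u\<^sup>2 / 2)"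
    using assms by (simp add: field_simps)
  finally show ?thesis
    using assms by (simp add: abs_divide add_pos_nonneg pos_divide_le_eq)
qed

lemma integrable_score_gaussian:
  fixes s d V :: real
  assumes "0 < s" "0 < V"
  shows "integrable lborel (\<lambda>u. u / (s + u\<^sup>2 / 2) * exp (- ((u - d)\<^sup>2 / (2 * V))))"
proof (rule Bochner_Integration.integrable_bound)
  show "integrable lborel (\<lambda>u. (1 / s + 2) * sqrt (2 * pi * V) * normal_density d (sqrt V) u)"
    using assms by (intro integrable_mult_right integrable_normal_density) auto
  show "AE u in lborel. norm (u / (s + u\<^sup>2 / 2) * exp (- ((u - d)\<^sup>2 / (2 * V))))
      \<le> norm ((1 / s + 2) * sqrt (2 * pi * V) * normal_density d (sqrt V) u)"
    using mult_right_mono [OF abs_score_le [OF assms(1)]] assms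
    by (intro AE_I2) (simp add: normal_density_def abs_mult)
qed auto

lemma score_integral_reflect:
  fixes s m \<mu> V :: real
  shows "(\<integral>y. (m - y) / (s + (m - y)\<^sup>2 / 2) * exp (- ((\<mu> - y)\<^sup>2 / (2 * V))) \<partial>lborel)
    = (\<integral>u. u / (s + u\<^sup>2 / 2) * exp (- ((u - (m - \<mu>))\<^sup>2 / (2 * V))) \<partial>lborel)"
  by (subst lborel_integral_real_affine [of "-1" _ m]) (simp_all add: algebra_simps)

lemma score_integral_pos:
  fixes s m \<mu> V :: real
  assumes "0 < s" "0 < V" "\<mu> < m"
  shows "0 < (\<integral>y. (m - y) / (s + (m - y)\<^sup>2 / 2) * exp (- ((\<mu> - y)\<^sup>2 / (2 * V))) \<partial>lborel)"
  unfolding score_integral_reflect using assms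
  by (intro integral_odd_times_shifted_gaussian_pos integrable_score_gaussian)
     (auto intro!: divide_pos_pos add_pos_nonneg)

text \<open>
  The reflection of the line that exchanges \<open>m\<close> and \<open>\<mu>\<close> transfers the sign for \<open>\<mu> < m\<close> to
  \<open>m < \<mu>\<close>, and for \<open>m = \<mu>\<close> it forces the integral to vanish.
\<close>

lemma score_integral_swap:
  fixes s m \<mu> V :: real
  shows "(\<integral>y. (m - y) / (s + (m - y)\<^sup>2 / 2) * exp (- ((\<mu> - y)\<^sup>2 / (2 * V))) \<partial>lborel)
    = - (\<integral>y. (\<mu> - y) / (s + (\<mu> - y)\<^sup>2 / 2) * exp (- ((m - y)\<^sup>2 / (2 * V))) \<partial>lborel)"
proof -
  have reflect: "m - (m + \<mu> + - (1 * y)) = - (\<mu> - y)" "\<mu> - (m + \<mu> + - (1 * y)) = - (m - y)" for y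
    by simp_all
  have "(\<integral>y. (m - y) / (s + (m - y)\<^sup>2 / 2) * exp (- ((\<mu> - y)\<^sup>2 / (2 * V))) \<partial>lborel)
    = (\<integral>y. - ((\<mu> - y) / (s + (\<mu> - y)\<^sup>2 / 2) * exp (- ((m - y)\<^sup>2 / (2 * V)))) \<partial>lborel)"
    by (subst lborel_integral_real_affine [of "-1" _ "m + \<mu>"], simp)
       (simp only: reflect power2_minus minus_divide_left [symmetric] mult_minus_left
          abs_neg_one scaleR_one)
  then show ?thesis by simp
qed

theorem theorem3p1:
  fixes M :: "'a measure" and Y :: "'a \<Rightarrow> real" and V \<alpha> \<beta> \<nu> :: real
  assumes "prob_space M"
    and "V > 0"
    and "distributed M lborel Y (\<lambda>y. ennreal (normal_density (integral\<^sup>L M Y) (sqrt V) y))"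
    and "\<alpha> > 0" and "\<beta> > 0" and "\<nu> > 0"
  shows "let \<mu> = integral\<^sup>L M Y; \<sigma> = \<beta> * (\<nu> + 1) / \<nu> in
      (\<forall>m y. (\<lambda>m'. K (posterior y m \<alpha> \<beta> \<nu>) m' \<alpha> \<beta> \<nu>) differentiable (at m)) \<and>
      (\<forall>m. integrable M (\<lambda>\<omega>. dK_dm (Y \<omega>) m \<alpha> \<beta> \<nu>)) \<and>
      (\<forall>m. (\<integral>\<omega>. dK_dm (Y \<omega>) m \<alpha> \<beta> \<nu> \<partial>M) =
        (\<alpha> + 1/2) / (2 * pi * V) powr (1/2) *
          (\<integral>y. (m - y) / (\<sigma> + (m - y)\<^sup>2 / 2) * exp (- ((\<mu> - y)\<^sup>2 / (2 * V))) \<partial>lborel)) \<and>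
      (\<forall>m. m_equilibrium M Y m \<alpha> \<beta> \<nu> \<longleftrightarrow> m = \<mu>) \<and>
      (\<forall>m. m > \<mu> \<longrightarrow> m_dot M Y m \<alpha> \<beta> \<nu> < 0) \<and>
      (\<forall>m. m < \<mu> \<longrightarrow> m_dot M Y m \<alpha> \<beta> \<nu> > 0)"
proof -
  interpret prob_space M by fact
  define \<mu> where "\<mu> = integral\<^sup>L M Y"
  define \<sigma> where "\<sigma> = \<beta> * (\<nu> + 1) / \<nu>"
  define J where "J m = (\<integral>y. (m - y) / (\<sigma> + (m - y)\<^sup>2 / 2) * exp (- ((\<mu> - y)\<^sup>2 / (2 * V))) \<partial>lborel)" for m
  define c where "c = (\<alpha> + 1/2) / (2 * pi * V) powr (1/2)"
  have \<sigma>: "0 < \<sigma>" and c: "0 < c" using assms by (simp_all add: \<sigma>_def c_def)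
  note D = assms(3) [folded \<mu>_def]
  have deriv: "((\<lambda>m'. K (posterior y m \<alpha> \<beta> \<nu>) m' \<alpha> \<beta> \<nu>) has_real_derivative
      (\<alpha> + 1/2) * ((m - y) / (\<sigma> + (m - y)\<^sup>2 / 2))) (at m)" for y m
    unfolding \<sigma>_def using assms(4-6) by (rule K_posterior_has_derivative)
  then have dK: "dK_dm y m \<alpha> \<beta> \<nu> = (\<alpha> + 1/2) * ((m - y) / (\<sigma> + (m - y)\<^sup>2 / 2))" for y m
    unfolding dK_dm_def by (rule DERIV_imp_deriv)
  have meas: "(\<lambda>y. dK_dm y m \<alpha> \<beta> \<nu>) \<in> borel_measurable lborel" for m
    unfolding dK by measurable
  have density: "normal_density \<mu> (sqrt V) y * dK_dm y m \<alpha> \<beta> \<nu>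
      = c * ((m - y) / (\<sigma> + (m - y)\<^sup>2 / 2) * exp (- ((\<mu> - y)\<^sup>2 / (2 * V))))" for y m
    using assms(2)
    by (simp add: dK normal_density_def c_def powr_half_sqrt power2_commute [of y \<mu>])
  have int: "integrable M (\<lambda>\<omega>. dK_dm (Y \<omega>) m \<alpha> \<beta> \<nu>)" for m
  proof (rule Bochner_Integration.integrable_bound)
    show "integrable M (\<lambda>\<omega>. (\<alpha> + 1/2) * (1 / \<sigma> + 2))" by simp
    show "(\<lambda>\<omega>. dK_dm (Y \<omega>) m \<alpha> \<beta> \<nu>) \<in> borel_measurable M"
      using measurable_compose [OF distributed_measurable [OF D] meas] .
    show "AE \<omega> in M. norm (dK_dm (Y \<omega>) m \<alpha> \<beta> \<nu>) \<le> norm ((\<alpha> + 1/2) * (1 / \<sigma> + 2))"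
    proof (rule AE_I2)
      fix \<omega>
      have "\<bar>(m - Y \<omega>) / (\<sigma> + (m - Y \<omega>)\<^sup>2 / 2)\<bar> \<le> \<bar>1 / \<sigma> + 2\<bar>"
        using abs_score_le [OF \<sigma>] by (rule order_trans) simp
      then show "norm (dK_dm (Y \<omega>) m \<alpha> \<beta> \<nu>) \<le> norm ((\<alpha> + 1/2) * (1 / \<sigma> + 2))"
        unfolding dK real_norm_def abs_mult by (rule mult_left_mono) simp
    qed
  qed
  have E: "(\<integral>\<omega>. dK_dm (Y \<omega>) m \<alpha> \<beta> \<nu> \<partial>M) = c * J m" for m
  proof -
    have "(\<integral>\<omega>. dK_dm (Y \<omega>) m \<alpha> \<beta> \<nu> \<partial>M)
        = (\<integral>y. normal_density \<mu> (sqrt V) y * dK_dm y m \<alpha> \<beta> \<nu> \<partial>lborel)"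
      by (rule distributed_integral [OF D meas, symmetric]) simp
    then show ?thesis by (simp only: density J_def integral_mult_right_zero)
  qed
  have J_pos: "0 < J m" if "\<mu> < m" for m
    unfolding J_def using \<sigma> assms(2) that by (rule score_integral_pos)
  have J_neg: "J m < 0" if "m < \<mu>" for m
    unfolding J_def score_integral_swap [of m] using score_integral_pos [OF \<sigma> assms(2) that] by simp
  have J_zero: "J \<mu> = 0"
    using score_integral_swap [of \<mu> \<sigma> \<mu> V] by (simp add: J_def)
  have dot: "m_dot M Y m \<alpha> \<beta> \<nu> = - (c * J m)" for m
    by (simp add: m_dot_def E)
  have diff: "(\<lambda>m'. K (posterior y m \<alpha> \<beta> \<nu>) m' \<alpha> \<beta> \<nu>) differentiable (at m)" for m y
    using deriv by (auto simp: real_differentiable_def)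
  have equilibrium: "m_equilibrium M Y m \<alpha> \<beta> \<nu> \<longleftrightarrow> m = \<mu>" for m
    using c J_pos [of m] J_neg [of m] J_zero
    by (cases m \<mu> rule: linorder_cases) (auto simp: m_equilibrium_def dot)
  have neg: "m_dot M Y m \<alpha> \<beta> \<nu> < 0" if "\<mu> < m" for m
    using c J_pos [OF that] by (simp add: dot)
  have pos: "m_dot M Y m \<alpha> \<beta> \<nu> > 0" if "m < \<mu>" for m
    using c J_neg [OF that] by (simp add: dot mult_pos_neg)
  show ?thesis
    unfolding Let_def \<mu>_def [symmetric] \<sigma>_def [symmetric] c_def [symmetric] J_def [symmetric]
    by (intro conjI allI impI diff int E equilibrium neg pos)
qed

end
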